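(* Let $N\ge 1$, $d_0,d_1,\dots,d_N\ge 1$ and $p_1,\dots,p_N\ge 1$ be integers, and put $d=\sum_{i=0}^N d_i$ and $p=\sum_{i=1}^N p_i$. Let the vectors $\mathbf a,\mathbf t\in\mathbb R^p$ and the blocks $\mathbf D_{i,0}\in\mathcal M_{p_i,d_0}(\mathbb R)$, $\mathbf D_{i,i}\in\mathcal M_{p_i,d_i}(\mathbb R)$ ($1\le i\le N$) and $\mathbf C_{i,j}\in\mathcal M_{p_i,p_j}(\mathbb R)$ ($1\le i\ne j\le N$) be random, all of their entries being independent random variables uniformly distributed on $[0,1]$. Let $\mathbf C\in\mathcal M_{p}(\mathbb R)$, $\mathbf D\in\mathcal M_{p,d}(\mathbb R)$ be the block matrices built from these blocks, assume that $\mathbf C$ is invertible (almost surely), and let $\boldsymbol\beta=-\mathbf C^{-1}\mathbf D$ and $\mathbf Q=2(\mathbf Q_{x_0}+\boldsymbol\beta^\top\boldsymbol\beta)\in\mathcal M_d(\mathbb R)$. If $p_i\ge d_i$ for all $i\in\{1,\dots,N\}$ and $p\ge d$, then $\mathbf Q$ is positive definite with probability $1$.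
   Context: $\mathcal M_{m,n}(\mathbb R)$ denotes the real $m\times n$ matrices and $\mathcal M_n(\mathbb R)=\mathcal M_{n,n}(\mathbb R)$. The block matrices are $$\mathbf D=\begin{pmatrix}\mathbf D_{1,0}&\mathbf D_{1,1}&\cdots&\mathbf 0\\ \vdots&\vdots&\ddots&\vdots\\ \mathbf D_{N,0}&\mathbf 0&\cdots&\mathbf D_{N,N}\end{pmatrix}\in\mathcal M_{p,d}(\mathbb R),$$ i.e. the first block column (of width $d_0$) consists of $\mathbf D_{1,0},\dots,\mathbf D_{N,0}$, and the remaining columns form the block-diagonal matrix with diagonal blocks $\mathbf D_{1,1},\dots,\mathbf D_{N,N}$; $$\mathbf C=\begin{pmatrix}\mathbf I&-\mathbf C_{1,2}&\cdots&-\mathbf C_{1,N}\\ -\mathbf C_{2,1}&\mathbf I&\ddots&-\mathbf C_{2,N}\\ \vdots&\ddots&\ddots&\vdots\\ -\mathbf C_{N,1}&-\mathbf C_{N,2}&\cdots&\mathbf I\end{pmatrix}\in\mathcal M_p(\mathbb R),$$ with identity matrices $\mathbf I$ of size $p_i$ as diagonal blocks; and $$\mathbf Q_{x_0}=\begin{pmatrix}\mathbf I_{d_0}&\mathbf 0\\ \mathbf 0&\mathbf 0\end{pmatrix}\in\mathcal M_d(\mathbb R).$$ The vectors $\mathbf a$ and $\mathbf t$ do not enter the definition of $\mathbf Q$. *)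

theory Defs
  imports "HOL-Probability.Probability" "Jordan_Normal_Form.Gauss_Jordan_Elimination"
begin

unbundle no vec_syntax and no inner_syntax

definition append_cols :: "'a :: zero mat \<Rightarrow> 'a mat \<Rightarrow> 'a mat" where
  "append_cols A B = four_block_mat A B (0\<^sub>m 0 (dim_col A)) (0\<^sub>m 0 (dim_col B))"

(* The matrix with block rows I and block columns J (in list order) whose (i,j) block is B i j,
   of size h i times w j; the sizes matter only for empty I or J. *)
definition block_mat ::
    "(nat \<Rightarrow> nat) \<Rightarrow> (nat \<Rightarrow> nat) \<Rightarrow> nat list \<Rightarrow> nat list \<Rightarrow> (nat \<Rightarrow> nat \<Rightarrow> 'a :: zero mat) \<Rightarrow> 'a mat" where
  "block_mat h w I J B =
     foldr (\<lambda>i X. foldr (\<lambda>j Y. append_cols (B i j) Y) J (0\<^sub>m (h i) 0) @\<^sub>r X)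
       I (0\<^sub>m 0 (\<Sum>j\<leftarrow>J. w j))"

(* Only the blocks D i 0 and D i i with 1 \<le> i \<le> N are used. *)
definition D_mat :: "nat \<Rightarrow> (nat \<Rightarrow> nat) \<Rightarrow> (nat \<Rightarrow> nat) \<Rightarrow> (nat \<Rightarrow> nat \<Rightarrow> real mat) \<Rightarrow> real mat" where
  "D_mat N p d D = block_mat p d [1..<Suc N] [0..<Suc N]
     (\<lambda>i j. if j = 0 \<or> j = i then D i j else 0\<^sub>m (p i) (d j))"

(* Only the blocks C i j with 1 \<le> i, j \<le> N and i \<noteq> j are used. *)
definition C_mat :: "nat \<Rightarrow> (nat \<Rightarrow> nat) \<Rightarrow> (nat \<Rightarrow> nat \<Rightarrow> real mat) \<Rightarrow> real mat" where
  "C_mat N p C = block_mat p p [1..<Suc N] [1..<Suc N]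
     (\<lambda>i j. if i = j then 1\<^sub>m (p i) else - C i j)"

definition Q_x0 :: "nat \<Rightarrow> (nat \<Rightarrow> nat) \<Rightarrow> real mat" where
  "Q_x0 N d = (let n = \<Sum>i=1..N. d i in
     four_block_mat (1\<^sub>m (d 0)) (0\<^sub>m (d 0) n) (0\<^sub>m n (d 0)) (0\<^sub>m n n))"

(* Meaningful for invertible C only: otherwise mat_inverse returns None. *)
definition beta_mat :: "real mat \<Rightarrow> real mat \<Rightarrow> real mat" where
  "beta_mat C D = - the (mat_inverse C) * D"

definition Q_mat ::
    "nat \<Rightarrow> (nat \<Rightarrow> nat) \<Rightarrow> (nat \<Rightarrow> nat) \<Rightarrow> (nat \<Rightarrow> nat \<Rightarrow> real mat) \<Rightarrow> (nat \<Rightarrow> nat \<Rightarrow> real mat) \<Rightarrow> real mat" where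
  "Q_mat N p d D C = (let \<beta> = beta_mat (C_mat N p C) (D_mat N p d D) in
     2 \<cdot>\<^sub>m (Q_x0 N d + \<beta>\<^sup>T * \<beta>))"

definition positive_definite :: "nat \<Rightarrow> real mat \<Rightarrow> bool" where
  "positive_definite n A \<longleftrightarrow> A \<in> carrier_mat n n \<and> A\<^sup>T = A \<and>
     (\<forall>x \<in> carrier_vec n. x \<noteq> 0\<^sub>v n \<longrightarrow> x \<bullet> (A *\<^sub>v x) > 0)"

(* Positions of the random scalars: D_entry i j r c is entry (r,c), counted from 0, of block D i j. *)
datatype entry =
    a_entry nat
  | t_entry nat
  | D_entry nat nat nat nat
  | C_entry nat nat nat nat

definition entries :: "nat \<Rightarrow> (nat \<Rightarrow> nat) \<Rightarrow> (nat \<Rightarrow> nat) \<Rightarrow> entry set" where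
  "entries N p d =
     {a_entry k | k. k < (\<Sum>i=1..N. p i)} \<union>
     {t_entry k | k. k < (\<Sum>i=1..N. p i)} \<union>
     {D_entry i j r c | i j r c. i \<in> {1..N} \<and> (j = 0 \<or> j = i) \<and> r < p i \<and> c < d j} \<union>
     {C_entry i j r c | i j r c. i \<in> {1..N} \<and> j \<in> {1..N} \<and> i \<noteq> j \<and> r < p i \<and> c < p j}"

fun entry_val ::
    "('w \<Rightarrow> real vec) \<Rightarrow> ('w \<Rightarrow> real vec) \<Rightarrow> (nat \<Rightarrow> nat \<Rightarrow> 'w \<Rightarrow> real mat) \<Rightarrow>
     (nat \<Rightarrow> nat \<Rightarrow> 'w \<Rightarrow> real mat) \<Rightarrow> entry \<Rightarrow> 'w \<Rightarrow> real" where
  "entry_val a t D C (a_entry k) \<omega> = a \<omega> $ k"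
| "entry_val a t D C (t_entry k) \<omega> = t \<omega> $ k"
| "entry_val a t D C (D_entry i j r c) \<omega> = D i j \<omega> $$ (r, c)"
| "entry_val a t D C (C_entry i j r c) \<omega> = C i j \<omega> $$ (r, c)"

end

theory Submission
  imports Defs "Jordan_Normal_Form.Determinant"
begin

text \<open>
  Up to the factor 2, the quadratic form of Q at x is the squared norm of the first block of x plus
  the squared norm of \<open>\<beta> x\<close>. If it vanishes, then the first block of x is zero and, C being
  invertible, D x = 0; the block structure of D turns this into \<open>D i i x\<^sub>i = 0\<close> for every i. So it
  suffices that almost surely every \<open>D i i\<close> is injective, which holds once its top \<open>d i \<times> d i\<close> minor is
  nonzero. The determinant of a square matrix with independent atomless entries is almost surely
  nonzero by induction on the size: it is affine in its last entry, which is independent of the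
  other entries, and the slope is the determinant of the leading principal submatrix.
\<close>

section \<open>Almost sure statements about independent random variables\<close>

text \<open>Fubini: independence makes the joint law of \<open>X\<close> and \<open>Y\<close> the
  product of their laws, so it is enough to test \<open>P\<close> with \<open>X\<close> frozen at
  one sample point and \<open>Y\<close> evaluated at a second, unrelated one.\<close>

lemma (in prob_space) AE_indep_var:
  assumes "indep_var S X T Y"
    and P: "Measurable.pred (S \<Otimes>\<^sub>M T) (\<lambda>(x, y). P x y)"
    and ae: "AE \<omega> in M. AE \<omega>' in M. P (X \<omega>) (Y \<omega>')"
  shows "AE \<omega> in M. P (X \<omega>) (Y \<omega>)"
proof -
  have X [measurable]: "X \<in> measurable M S" and Y [measurable]: "Y \<in> measurable M T"
    and eq: "distr M S X \<Otimes>\<^sub>M distr M T Y = distr M (S \<Otimes>\<^sub>M T) (\<lambda>\<omega>. (X \<omega>, Y \<omega>))"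
    using assms(1) unfolding indep_var_distribution_eq by auto
  interpret X: prob_space "distr M S X" by (rule prob_space_distr) fact
  interpret Y: prob_space "distr M T Y" by (rule prob_space_distr) fact
  interpret XY: pair_prob_space "distr M S X" "distr M T Y" ..
  note P [measurable]
  have sec: "(AE y in distr M T Y. P x y) \<longleftrightarrow> (AE \<omega> in M. P x (Y \<omega>))" if [measurable]: "x \<in> space S" for x
    by (rule AE_distr_iff) measurable
  \<comment> \<open>Transferring the inner almost sure statement along the law of \<open>X\<close>
    requires a measurable set of good \<open>x\<close>. Goodness is expressed as the vanishing of
    the measure of a section, which is a measurable function of \<open>x\<close>.\<close>
  have meas: "{x \<in> space S. AE y in distr M T Y. P x y} \<in> sets S"
  proof -
    have null: "(AE y in distr M T Y. P x y) \<longleftrightarrow> emeasure (distr M T Y) {y \<in> space T. \<not> P x y} = 0"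
      if [measurable]: "x \<in> space S" for x
      by (rule AE_iff_measurable) simp_all
    have "(\<lambda>x. emeasure (distr M T Y) {y \<in> space T. \<not> P x y}) \<in> borel_measurable S"
    proof (rule Y.measurable_emeasure)
      have "{z \<in> space (S \<Otimes>\<^sub>M T). \<not> (case z of (x, y) \<Rightarrow> P x y)} \<in> sets (S \<Otimes>\<^sub>M T)"
        using P by measurable
      also have "{z \<in> space (S \<Otimes>\<^sub>M T). \<not> (case z of (x, y) \<Rightarrow> P x y)} =
          {z \<in> space (S \<Otimes>\<^sub>M distr M T Y). snd z \<in> {y \<in> space T. \<not> P (fst z) y}}"
        by (auto simp: space_pair_measure)
      finally show "{z \<in> space (S \<Otimes>\<^sub>M distr M T Y). snd z \<in> {y \<in> space T. \<not> P (fst z) y}}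
          \<in> sets (S \<Otimes>\<^sub>M distr M T Y)"
        by simp
    qed simp
    then have "{x \<in> space S. emeasure (distr M T Y) {y \<in> space T. \<not> P x y} = 0} \<in> sets S"
      by measurable
    then show ?thesis
      using null by (simp cong: conj_cong)
  qed
  have "AE \<omega> in M. AE y in distr M T Y. P (X \<omega>) y"
    using ae AE_space
  proof eventually_elim
    case (elim \<omega>)
    then show ?case using sec[of "X \<omega>"] measurable_space[OF X] by simp
  qed
  then have "AE x in distr M S X. AE y in distr M T Y. P x y"
    using AE_distr_iff[OF X meas] by blast
  then have "AE z in distr M S X \<Otimes>\<^sub>M distr M T Y. case z of (x, y) \<Rightarrow> P x y"
    by (intro XY.AE_pair_measure) (use P in \<open>simp_all add: pred_def space_pair_measure\<close>)
  then show ?thesis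
    unfolding eq by (subst (asm) AE_distr_iff) (use P in \<open>simp_all add: pred_def\<close>)
qed

text \<open>The singletons \<open>{f j}\<close> are disjoint by injectivity, so grouping the
  variables along them keeps independence; evaluating each group at its only index gives back the
  variable.\<close>

lemma (in prob_space) indep_vars_reindex:
  assumes "indep_vars N X (f ` I)" and "inj_on f I"
  shows "indep_vars (N \<circ> f) (X \<circ> f) I"
proof -
  have "indep_vars (\<lambda>j. PiM {f j} N) (\<lambda>j \<omega>. restrict (\<lambda>i. X i \<omega>) {f j}) I"
    by (rule indep_vars_restrict[OF assms(1)]) (use assms(2) in \<open>auto simp: disjoint_family_on_def inj_on_def\<close>)
  then have "indep_vars (N \<circ> f) (\<lambda>j \<omega>. restrict (\<lambda>i. X i \<omega>) {f j} (f j)) I"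
    by (rule indep_vars_compose2[where Y = "\<lambda>j g. g (f j)"]) auto
  then show ?thesis by (simp add: comp_def)
qed

section \<open>Determinants of matrices with random entries\<close>

text \<open>By the Leibniz formula the determinant is a polynomial in the entries.\<close>

lemma borel_measurable_det:
  fixes F :: "'w \<Rightarrow> nat \<times> nat \<Rightarrow> real"
  assumes "\<And>i j. i < n \<Longrightarrow> j < n \<Longrightarrow> (\<lambda>\<omega>. F \<omega> (i, j)) \<in> borel_measurable M"
  shows "(\<lambda>\<omega>. Determinant.det (Matrix.mat n n (F \<omega>))) \<in> borel_measurable M"
proof -
  have "Determinant.det (Matrix.mat n n (F \<omega>)) =
      (\<Sum>q | q permutes {0..<n}. signof q * (\<Prod>i = 0..<n. F \<omega> (i, q i)))" for \<omega>
  proof -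
    have "Matrix.mat n n (F \<omega>) $$ (i, q i) = F \<omega> (i, q i)" if "q permutes {0..<n}" "i < n" for q i
      using that permutes_in_image[OF that(1), of i] by simp
    then show ?thesis
      by (subst det_def'[of _ n]) (auto intro!: sum.cong prod.cong)
  qed
  moreover have "(\<lambda>\<omega>. \<Sum>q | q permutes {0..<n}. signof q * (\<Prod>i = 0..<n. F \<omega> (i, q i)))
      \<in> borel_measurable M"
    by (intro borel_measurable_sum borel_measurable_times borel_measurable_prod
        borel_measurable_const assms) (use permutes_in_image in fastforce)+
  ultimately show ?thesis by simp
qed

text \<open>Writing the constant term as a determinant as well makes its measurability an instance of
  the previous lemma.\<close>

lemma det_mat_Suc:
  fixes f :: "nat \<times> nat \<Rightarrow> 'a :: comm_ring_1"
  shows "Determinant.det (Matrix.mat (Suc n) (Suc n) f) =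
    f (n, n) * Determinant.det (Matrix.mat n n f) +
    Determinant.det (Matrix.mat (Suc n) (Suc n) (f((n, n) := 0)))"
proof -
  let ?m = "\<lambda>f. Matrix.mat (Suc n) (Suc n) f :: 'a mat"
  have expand: "Determinant.det (?m g) =
      g (n, n) * cofactor (?m g) n n + (\<Sum>j<n. g (n, j) * cofactor (?m g) n j)" for g
    using laplace_expansion_row[of "?m g" "Suc n" n] by (simp add: add.commute)
  have minor: "cofactor (?m g) n n = Determinant.det (Matrix.mat n n g)" for g
  proof -
    have "mat_delete (?m g) n n = Matrix.mat n n g"
      by (rule eq_matI) (auto simp: mat_delete_def)
    then show ?thesis by (simp add: cofactor_def)
  qed
  have "mat_delete (?m f) n j = mat_delete (?m (f((n, n) := 0))) n j" for j
    by (rule eq_matI) (auto simp: mat_delete_def)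
  then show ?thesis
    unfolding expand minor by (simp add: cofactor_def)
qed

text \<open>Independence and absence of atoms both pass to the leading principal submatrix, as the
  induction on \<open>n\<close> requires. It starts from the empty determinant, which is 1.\<close>

lemma (in prob_space) AE_det_nonzero:
  fixes X :: "nat \<times> nat \<Rightarrow> 'a \<Rightarrow> real"
  assumes "indep_vars (\<lambda>_. borel) X ({..<n} \<times> {..<n})"
    and "\<And>e c. e \<in> {..<n} \<times> {..<n} \<Longrightarrow> AE \<omega> in M. X e \<omega> \<noteq> c"
  shows "AE \<omega> in M. Determinant.det (Matrix.mat n n (\<lambda>e. X e \<omega>)) \<noteq> 0"
  using assms
proof (induction n)
  case 0
  then show ?case by simp
next
  case (Suc n)
  let ?I = "{..<Suc n} \<times> {..<Suc n}"
  let ?E = "{(n, n)}"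
  let ?R = "?I - ?E"
  \<comment> \<open>Slope \<open>Y\<close> and constant term \<open>Z\<close> of the determinant as
    an affine function of entry (n, n). Overwriting that entry by 0 makes \<open>Z\<close> depend on
    the coordinates in \<open>?R\<close> only, like \<open>Y\<close>, so both are independent of the
    last entry.\<close>
  define Y :: "(nat \<times> nat \<Rightarrow> real) \<Rightarrow> real" where "Y = (\<lambda>f. Determinant.det (Matrix.mat n n f))"
  define Z :: "(nat \<times> nat \<Rightarrow> real) \<Rightarrow> real"
    where "Z = (\<lambda>f. Determinant.det (Matrix.mat (Suc n) (Suc n) (f((n, n) := 0))))"
  have [measurable]: "Y \<in> borel_measurable (PiM ?R (\<lambda>_. borel))"
    unfolding Y_def by (rule borel_measurable_det) (auto intro!: measurable_component_singleton)
  have [measurable]: "Z \<in> borel_measurable (PiM ?R (\<lambda>_. borel))"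
    unfolding Z_def
  proof (rule borel_measurable_det)
    fix i j assume "i < Suc n" "j < Suc n"
    then show "(\<lambda>f. (f((n, n) := 0)) (i, j)) \<in> borel_measurable (PiM ?R (\<lambda>_. borel :: real measure))"
      by (cases "(i, j) = (n, n)") (auto intro!: measurable_component_singleton)
  qed
  let ?XR = "\<lambda>\<omega>. restrict (\<lambda>e. X e \<omega>) ?R" and ?XE = "\<lambda>\<omega>. restrict (\<lambda>e. X e \<omega>) ?E"
  have "Matrix.mat n n (?XR \<omega>) = Matrix.mat n n (\<lambda>e. X e \<omega>)" for \<omega>
    by (rule eq_matI) auto
  then have Y: "Y (?XR \<omega>) = Determinant.det (Matrix.mat n n (\<lambda>e. X e \<omega>))" for \<omega>
    by (simp add: Y_def)
  have "Matrix.mat (Suc n) (Suc n) ((?XR \<omega>)((n, n) := 0)) =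
      Matrix.mat (Suc n) (Suc n) ((\<lambda>e. X e \<omega>)((n, n) := 0))" for \<omega>
    by (rule eq_matI) auto
  then have split: "Determinant.det (Matrix.mat (Suc n) (Suc n) (\<lambda>e. X e \<omega>)) =
      ?XE \<omega> (n, n) * Y (?XR \<omega>) + Z (?XR \<omega>)" for \<omega>
    unfolding det_mat_Suc[of n "\<lambda>e. X e \<omega>"] Y by (simp add: Z_def)
  have "AE \<omega> in M. ?XE \<omega> (n, n) * Y (?XR \<omega>) + Z (?XR \<omega>) \<noteq> 0"
  proof (rule AE_indep_var[where X = ?XR and Y = ?XE and P = "\<lambda>f g. g (n, n) * Y f + Z f \<noteq> 0"])
    show "indep_var (PiM ?R (\<lambda>_. borel)) ?XR (PiM ?E (\<lambda>_. borel)) ?XE"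
      by (rule indep_var_restrict[OF Suc.prems(1)]) auto
    show "Measurable.pred (PiM ?R (\<lambda>_. borel) \<Otimes>\<^sub>M PiM ?E (\<lambda>_. borel))
        (\<lambda>(f, g). g (n, n) * Y f + Z f \<noteq> 0)"
      by measurable
    have "AE \<omega> in M. Y (?XR \<omega>) \<noteq> 0"
      unfolding Y using Suc.prems by (intro Suc.IH indep_vars_subset[OF Suc.prems(1)]) auto
    then show "AE \<omega> in M. AE \<omega>' in M. ?XE \<omega>' (n, n) * Y (?XR \<omega>) + Z (?XR \<omega>) \<noteq> 0"
    proof eventually_elim
      case (elim \<omega>)
      \<comment> \<open>With the other entries frozen at \<omega> and nonzero slope, the affine
        function has a single root, which an atomless entry avoids almost surely.\<close>
      have "AE \<omega>' in M. X (n, n) \<omega>' \<noteq> - Z (?XR \<omega>) / Y (?XR \<omega>)"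
        by (intro Suc.prems(2)) auto
      then show ?case
        by eventually_elim (use elim in \<open>auto simp: field_simps\<close>)
    qed
  qed
  then show ?case unfolding split .
qed

section \<open>Injectivity of tall matrices and auxiliary vector identities\<close>

text \<open>The first \<open>n\<close> equations alone already form a nonsingular square
  system.\<close>

lemma mult_mat_vec_injective:
  fixes A :: "'a :: field mat"
  assumes A: "A \<in> carrier_mat m n" and "n \<le> m"
    and det: "Determinant.det (Matrix.mat n n (\<lambda>e. A $$ e)) \<noteq> 0"
    and x: "x \<in> carrier_vec n" and Ax: "A *\<^sub>v x = 0\<^sub>v m"
  shows "x = 0\<^sub>v n"
proof (rule ccontr)
  assume "x \<noteq> 0\<^sub>v n"
  have "Matrix.mat n n (\<lambda>e. A $$ e) *\<^sub>v x = 0\<^sub>v n"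
  proof (rule eq_vecI)
    fix i assume i: "i < dim_vec (0\<^sub>v n)"
    then have "(Matrix.mat n n (\<lambda>e. A $$ e) *\<^sub>v x) $ i = (A *\<^sub>v x) $ i"
      using A x \<open>n \<le> m\<close> by (auto simp: scalar_prod_def)
    then show "(Matrix.mat n n (\<lambda>e. A $$ e) *\<^sub>v x) $ i = 0\<^sub>v n $ i"
      using i \<open>n \<le> m\<close> by (simp add: Ax)
  qed auto
  then show False
    using det det_0_iff_vec_prod_zero_field[of "Matrix.mat n n (\<lambda>e. A $$ e)" n] x \<open>x \<noteq> 0\<^sub>v n\<close> by auto
qed

lemma smult_mat_mult_vec:
  fixes A :: "'a :: comm_semiring_0 mat"
  assumes "A \<in> carrier_mat m n" "x \<in> carrier_vec n"
  shows "(k \<cdot>\<^sub>m A) *\<^sub>v x = k \<cdot>\<^sub>v (A *\<^sub>v x)"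
  by (rule eq_vecI) (use assms in \<open>auto simp: scalar_prod_def sum_distrib_left mult.assoc\<close>)

lemma vec_first_append:
  assumes "x \<in> carrier_vec n"
  shows "vec_first (x @\<^sub>v y) n = x"
  by (rule eq_vecI) (use assms in \<open>auto simp: vec_first_def\<close>)

section \<open>Block matrices acting on block vectors\<close>

lemma append_cols_carrier:
  assumes "A \<in> carrier_mat m n" "B \<in> carrier_mat m k"
  shows "append_cols A B \<in> carrier_mat m (n + k)"
  using assms unfolding append_cols_def by auto

text \<open>\<open>append_cols\<close> is a four-block matrix whose lower blocks have no rows, so
  the product formula for four blocks applies and its lower half is the empty vector.\<close>

lemma append_cols_mult_vec:
  fixes A :: "'a :: comm_ring_1 mat"
  assumes "A \<in> carrier_mat m n" "B \<in> carrier_mat m k" "x \<in> carrier_vec n" "y \<in> carrier_vec k"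
  shows "append_cols A B *\<^sub>v (x @\<^sub>v y) = A *\<^sub>v x + B *\<^sub>v y"
proof -
  have "append_cols A B *\<^sub>v (x @\<^sub>v y) =
      (A *\<^sub>v x + B *\<^sub>v y) @\<^sub>v (0\<^sub>m 0 n *\<^sub>v x + 0\<^sub>m 0 k *\<^sub>v y)"
    using four_block_mat_mult_vec[OF assms(1,2) zero_carrier_mat[of 0 n] zero_carrier_mat[of 0 k] assms(3,4)]
      assms(1,2) by (simp add: append_cols_def)
  also have "\<dots> = A *\<^sub>v x + B *\<^sub>v y"
    by (rule eq_vecI) (use assms in auto)
  finally show ?thesis .
qed

text \<open>The inner fold of \<open>block_mat\<close>, named so that a block matrix can be treated
  one block row at a time.\<close>

definition block_row :: "nat \<Rightarrow> nat list \<Rightarrow> (nat \<Rightarrow> 'a :: zero mat) \<Rightarrow> 'a mat" where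
  "block_row h J B = foldr (\<lambda>j Y. append_cols (B j) Y) J (0\<^sub>m h 0)"

text \<open>Folded in the same order as \<open>block_row\<close>, so that both unfold together in an
  induction over \<open>J\<close>.\<close>

definition block_vec :: "nat list \<Rightarrow> (nat \<Rightarrow> 'a vec) \<Rightarrow> 'a vec" where
  "block_vec J x = foldr (\<lambda>j v. x j @\<^sub>v v) J vNil"

lemma block_mat_Cons:
  "block_mat h w (i # I) J B = block_row (h i) J (B i) @\<^sub>r block_mat h w I J B"
  by (simp add: block_mat_def block_row_def)

lemma block_row_carrier:
  assumes "\<And>j. j \<in> set J \<Longrightarrow> B j \<in> carrier_mat h (w j)"
  shows "block_row h J B \<in> carrier_mat h (\<Sum>j\<leftarrow>J. w j)"
  using assms by (induction J) (auto simp: block_row_def intro!: append_cols_carrier)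

lemma block_mat_carrier:
  assumes "\<And>i j. i \<in> set I \<Longrightarrow> j \<in> set J \<Longrightarrow> B i j \<in> carrier_mat (h i) (w j)"
  shows "block_mat h w I J B \<in> carrier_mat (\<Sum>i\<leftarrow>I. h i) (\<Sum>j\<leftarrow>J. w j)"
  using assms
proof (induction I)
  case Nil
  then show ?case by (simp add: block_mat_def)
next
  case (Cons i I)
  then show ?case
    by (auto simp: block_mat_Cons intro!: carrier_append_rows block_row_carrier)
qed

lemma block_vec_carrier:
  assumes "\<And>j. j \<in> set J \<Longrightarrow> x j \<in> carrier_vec (w j)"
  shows "block_vec J x \<in> carrier_vec (\<Sum>j\<leftarrow>J. w j)"
  using assms by (induction J) (auto simp: block_vec_def)

lemma zero_vec_append: "0\<^sub>v m @\<^sub>v 0\<^sub>v n = 0\<^sub>v (m + n)"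
  by (rule eq_vecI) auto

lemma block_vec_zero:
  assumes "\<And>j. j \<in> set J \<Longrightarrow> x j = 0\<^sub>v (w j)"
  shows "block_vec J x = 0\<^sub>v (\<Sum>j\<leftarrow>J. w j)"
  using assms by (induction J) (auto simp: block_vec_def)

text \<open>The blocks are cut off the front of \<open>v\<close> one after another. Distinctness
  lets a function of the block index record them: a repeated index would force two blocks to be
  equal.\<close>

lemma ex_block_vec:
  assumes "v \<in> carrier_vec (\<Sum>j\<leftarrow>J. w j)" and "distinct J"
  shows "\<exists>x. (\<forall>j\<in>set J. x j \<in> carrier_vec (w j)) \<and> v = block_vec J x"
  using assms
proof (induction J arbitrary: v)
  case Nil
  then show ?case by (auto simp: block_vec_def intro!: eq_vecI)
next
  case (Cons j J)
  let ?n = "\<Sum>j\<leftarrow>J. w j"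
  have "\<exists>x. (\<forall>j\<in>set J. x j \<in> carrier_vec (w j)) \<and> vec_last v ?n = block_vec J x"
    by (rule Cons.IH[OF vec_last_carrier]) (use Cons.prems(2) in simp)
  then obtain x where
    x: "\<forall>j\<in>set J. x j \<in> carrier_vec (w j)" and last: "vec_last v ?n = block_vec J x"
    by blast
  let ?x = "x(j := vec_first v (w j))"
  have "foldr (\<lambda>j v. ?x j @\<^sub>v v) J vNil = block_vec J x"
    unfolding block_vec_def using Cons.prems(2) by (intro foldr_cong) auto
  then have "block_vec (j # J) ?x = vec_first v (w j) @\<^sub>v vec_last v ?n"
    unfolding last by (simp add: block_vec_def)
  also have "\<dots> = v"
    using Cons.prems(1) by simp
  finally have "v = block_vec (j # J) ?x" ..
  moreover have "\<forall>k\<in>set (j # J). ?x k \<in> carrier_vec (w k)" using x by simp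
  ultimately show ?case by blast
qed

lemma block_row_mult_vec_zero:
  fixes B :: "nat \<Rightarrow> 'a :: comm_ring_1 mat"
  assumes "\<And>j. j \<in> set J \<Longrightarrow> B j \<in> carrier_mat h (w j)"
    and "\<And>j. j \<in> set J \<Longrightarrow> x j \<in> carrier_vec (w j)"
    and "\<And>j. j \<in> set J \<Longrightarrow> B j *\<^sub>v x j = 0\<^sub>v h"
  shows "block_row h J B *\<^sub>v block_vec J x = 0\<^sub>v h"
  using assms
proof (induction J)
  case Nil
  then show ?case by (auto simp: block_row_def block_vec_def)
next
  case (Cons j J)
  have "block_row h (j # J) B *\<^sub>v block_vec (j # J) x =
      B j *\<^sub>v x j + block_row h J B *\<^sub>v block_vec J x"
    using append_cols_mult_vec[OF _ block_row_carrier _ block_vec_carrier, of "B j" h "w j" J B w "x j" x] Cons.prems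
    by (simp add: block_row_def block_vec_def)
  then show ?case using Cons by simp
qed

text \<open>All summands except the one at \<open>k\<close> vanish, and distinctness ensures that
  this one occurs only once.\<close>

lemma block_row_mult_vec_single:
  fixes B :: "nat \<Rightarrow> 'a :: comm_ring_1 mat"
  assumes "\<And>j. j \<in> set J \<Longrightarrow> B j \<in> carrier_mat h (w j)"
    and "\<And>j. j \<in> set J \<Longrightarrow> x j \<in> carrier_vec (w j)"
    and "\<And>j. j \<in> set J \<Longrightarrow> j \<noteq> k \<Longrightarrow> B j *\<^sub>v x j = 0\<^sub>v h"
    and "k \<in> set J" and "distinct J"
  shows "block_row h J B *\<^sub>v block_vec J x = B k *\<^sub>v x k"
  using assms
proof (induction J)
  case Nil
  then show ?case by simp
next
  case (Cons j J)
  have *: "block_row h (j # J) B *\<^sub>v block_vec (j # J) x =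
      B j *\<^sub>v x j + block_row h J B *\<^sub>v block_vec J x"
    using append_cols_mult_vec[OF _ block_row_carrier _ block_vec_carrier, of "B j" h "w j" J B w "x j" x] Cons.prems
    by (simp add: block_row_def block_vec_def)
  have Bk: "B k *\<^sub>v x k \<in> carrier_vec h"
    using Cons.prems(1,2,4) by (meson mult_mat_vec_carrier)
  show ?case
  proof (cases "j = k")
    case True
    have "block_row h J B *\<^sub>v block_vec J x = 0\<^sub>v h"
      by (rule block_row_mult_vec_zero[where w = w]) (use Cons.prems True in auto)
    then show ?thesis using * True Bk by simp
  next
    case False
    have "block_row h J B *\<^sub>v block_vec J x = B k *\<^sub>v x k"
      by (rule Cons.IH) (use Cons.prems False in auto)
    moreover have "B j *\<^sub>v x j = 0\<^sub>v h" using Cons.prems False by auto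
    ultimately show ?thesis using * Bk by simp
  qed
qed

text \<open>Stacking block rows turns the product into an appended vector, and this vanishes only if
  every piece does.\<close>

lemma block_mat_mult_vec_zeroD:
  fixes B :: "nat \<Rightarrow> nat \<Rightarrow> 'a :: comm_ring_1 mat"
  assumes "\<And>i j. i \<in> set I \<Longrightarrow> j \<in> set J \<Longrightarrow> B i j \<in> carrier_mat (h i) (w j)"
    and v: "v \<in> carrier_vec (\<Sum>j\<leftarrow>J. w j)"
    and "block_mat h w I J B *\<^sub>v v = 0\<^sub>v (\<Sum>i\<leftarrow>I. h i)"
    and "i \<in> set I"
  shows "block_row (h i) J (B i) *\<^sub>v v = 0\<^sub>v (h i)"
  using assms(1,3,4)
proof (induction I)
  case Nil
  then show ?case by simp
next
  case (Cons k I)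
  have row: "block_row (h k) J (B k) \<in> carrier_mat (h k) (\<Sum>j\<leftarrow>J. w j)"
    using Cons.prems by (intro block_row_carrier) auto
  have rest: "block_mat h w I J B \<in> carrier_mat (\<Sum>i\<leftarrow>I. h i) (\<Sum>j\<leftarrow>J. w j)"
    using Cons.prems by (intro block_mat_carrier) auto
  have "block_row (h k) J (B k) *\<^sub>v v @\<^sub>v block_mat h w I J B *\<^sub>v v = 0\<^sub>v (h k) @\<^sub>v 0\<^sub>v (\<Sum>i\<leftarrow>I. h i)"
    using Cons.prems(2) by (simp add: block_mat_Cons mat_mult_append[OF row rest v] zero_vec_append)
  then have "block_row (h k) J (B k) *\<^sub>v v = 0\<^sub>v (h k)" "block_mat h w I J B *\<^sub>v v = 0\<^sub>v (\<Sum>i\<leftarrow>I. h i)"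
    using append_vec_eq[OF mult_mat_vec_carrier[OF row v] zero_carrier_vec] by auto
  then show ?case using Cons by auto
qed

section \<open>The concrete matrices D, C and the projection onto the first block\<close>

lemma D_mat_carrier:
  assumes "\<And>i. i \<in> {1..N} \<Longrightarrow> D i 0 \<in> carrier_mat (p i) (d 0)"
    and "\<And>i. i \<in> {1..N} \<Longrightarrow> D i i \<in> carrier_mat (p i) (d i)"
  shows "D_mat N p d D \<in> carrier_mat (\<Sum>i=1..N. p i) (\<Sum>i=0..N. d i)"
proof -
  have "D_mat N p d D \<in> carrier_mat (\<Sum>i\<leftarrow>[1..<Suc N]. p i) (\<Sum>i\<leftarrow>[0..<Suc N]. d i)"
    unfolding D_mat_def using assms by (intro block_mat_carrier) auto
  then show ?thesis
    by (simp only: interv_sum_list_conv_sum_set_nat set_upt atLeastLessThanSuc_atLeastAtMost)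
qed

lemma C_mat_carrier:
  assumes "\<And>i j. i \<in> {1..N} \<Longrightarrow> j \<in> {1..N} \<Longrightarrow> i \<noteq> j \<Longrightarrow> C i j \<in> carrier_mat (p i) (p j)"
  shows "C_mat N p C \<in> carrier_mat (\<Sum>i=1..N. p i) (\<Sum>i=1..N. p i)"
proof -
  have "C_mat N p C \<in> carrier_mat (\<Sum>i\<leftarrow>[1..<Suc N]. p i) (\<Sum>i\<leftarrow>[1..<Suc N]. p i)"
    unfolding C_mat_def using assms by (intro block_mat_carrier) auto
  then show ?thesis
    by (simp only: interv_sum_list_conv_sum_set_nat set_upt atLeastLessThanSuc_atLeastAtMost)
qed

lemma sum_from_0_eq: "(\<Sum>i=0..N. d i) = d 0 + (\<Sum>i=1..N. d i)" for d :: "nat \<Rightarrow> nat"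
  by (simp add: sum.atLeast_Suc_atMost)

text \<open>Once the first block of \<open>v\<close> is zero, the shared first block column
  contributes nothing and D acts block-diagonally: block row \<open>i\<close> sees only the block of
  \<open>v\<close> with index \<open>i\<close>.\<close>

lemma D_mat_kernel:
  assumes D0: "\<And>i. i \<in> {1..N} \<Longrightarrow> D i 0 \<in> carrier_mat (p i) (d 0)"
    and Di: "\<And>i. i \<in> {1..N} \<Longrightarrow> D i i \<in> carrier_mat (p i) (d i)"
    and inj: "\<And>i x. i \<in> {1..N} \<Longrightarrow> x \<in> carrier_vec (d i) \<Longrightarrow> D i i *\<^sub>v x = 0\<^sub>v (p i) \<Longrightarrow> x = 0\<^sub>v (d i)"
    and v: "v \<in> carrier_vec (\<Sum>i=0..N. d i)"
    and Dv: "D_mat N p d D *\<^sub>v v = 0\<^sub>v (\<Sum>i=1..N. p i)"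
    and first: "vec_first v (d 0) = 0\<^sub>v (d 0)"
  shows "v = 0\<^sub>v (\<Sum>i=0..N. d i)"
proof -
  define B where "B = (\<lambda>i j. if j = 0 \<or> j = i then D i j else 0\<^sub>m (p i) (d j))"
  let ?I = "[1..<Suc N]" and ?J = "[0..<Suc N]"
  have sums: "(\<Sum>i\<leftarrow>?J. d i) = (\<Sum>i=0..N. d i)" "(\<Sum>i\<leftarrow>?I. p i) = (\<Sum>i=1..N. p i)"
    by (simp_all only: interv_sum_list_conv_sum_set_nat set_upt atLeastLessThanSuc_atLeastAtMost)
  have B: "B i j \<in> carrier_mat (p i) (d j)" if "i \<in> set ?I" for i j
    using that D0 Di by (auto simp: B_def)
  obtain x where x: "\<And>j. j \<in> set ?J \<Longrightarrow> x j \<in> carrier_vec (d j)" and vx: "v = block_vec ?J x"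
    using ex_block_vec[of v d ?J] v distinct_upt unfolding sums by blast
  have x0: "x 0 = 0\<^sub>v (d 0)"
  proof -
    \<comment> \<open>Peeling index 0 off the front of the list exposes the first block of
      \<open>v\<close>.\<close>
    have "v = x 0 @\<^sub>v block_vec [1..<Suc N] x"
      unfolding vx by (subst upt_rec) (simp add: block_vec_def)
    moreover have "x 0 \<in> carrier_vec (d 0)" using x[of 0] by (simp del: upt_Suc)
    ultimately show ?thesis using first vec_first_append by metis
  qed
  have "x i = 0\<^sub>v (d i)" if i: "i \<in> {1..N}" for i
  proof -
    have "block_row (p i) ?J (B i) *\<^sub>v v = 0\<^sub>v (p i)"
    proof (rule block_mat_mult_vec_zeroD[where I = ?I and J = ?J and h = p and w = d and B = B])
      show "block_mat p d ?I ?J B *\<^sub>v v = 0\<^sub>v (\<Sum>i\<leftarrow>?I. p i)"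
        using Dv unfolding D_mat_def B_def sums by simp
    qed (use B v sums i in auto)
    moreover have "block_row (p i) ?J (B i) *\<^sub>v v = B i i *\<^sub>v x i"
      unfolding vx
    proof (rule block_row_mult_vec_single[where w = d and k = i])
      \<comment> \<open>For j = 0 the vector block is zero; for every other j \<noteq> i the matrix
        block is zero.\<close>
      fix j assume "j \<in> set ?J" "j \<noteq> i"
      then show "B i j *\<^sub>v x j = 0\<^sub>v (p i)"
        using D0[OF i] x[of j] x0 by (cases "j = 0") (auto simp: B_def)
    qed (use B x i in \<open>auto simp del: upt_Suc\<close>)
    ultimately show ?thesis
      using inj[OF i, of "x i"] x[of i] i by (simp add: B_def del: upt_Suc)
  qed
  then have "x j = 0\<^sub>v (d j)" if "j \<in> set ?J" for j
    using that x0 by (cases "j = 0") auto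
  then have "block_vec ?J x = 0\<^sub>v (\<Sum>j\<leftarrow>?J. d j)" by (rule block_vec_zero)
  then show ?thesis using vx sums by simp
qed

lemma Q_x0_carrier: "Q_x0 N d \<in> carrier_mat (\<Sum>i=0..N. d i) (\<Sum>i=0..N. d i)"
  unfolding Q_x0_def Let_def sum_from_0_eq by (rule four_block_carrier_mat) auto

lemma transpose_Q_x0: "(Q_x0 N d)\<^sup>T = Q_x0 N d"
  unfolding Q_x0_def Let_def by (subst transpose_four_block_mat) auto

text \<open>\<open>Q_x0\<close> is the orthogonal projection onto the first \<open>d 0\<close>
  coordinates.\<close>

lemma Q_x0_quadratic_form:
  assumes v: "v \<in> carrier_vec (\<Sum>i=0..N. d i)"
  shows "v \<bullet> (Q_x0 N d *\<^sub>v v) = vec_first v (d 0) \<bullet> vec_first v (d 0)"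
proof -
  define n where "n = (\<Sum>i=1..N. d i)"
  let ?x = "vec_first v (d 0)" and ?y = "vec_last v n"
  have vxy: "v = ?x @\<^sub>v ?y"
    using v unfolding sum_from_0_eq n_def by simp
  have "Q_x0 N d *\<^sub>v (?x @\<^sub>v ?y) = ?x @\<^sub>v 0\<^sub>v n"
    unfolding Q_x0_def Let_def n_def[symmetric]
    by (subst four_block_mat_mult_vec[of _ "d 0" "d 0" _ n _ n]) auto
  then have "v \<bullet> (Q_x0 N d *\<^sub>v v) = (?x @\<^sub>v ?y) \<bullet> (?x @\<^sub>v 0\<^sub>v n)"
    using vxy by metis
  also have "\<dots> = ?x \<bullet> ?x"
    by (subst scalar_prod_append[of _ "d 0" _ n]) auto
  finally show ?thesis .
qed

section \<open>Positive definiteness at a fixed sample point\<close>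

text \<open>\<open>invertible_mat\<close> yields a two-sided inverse without stating its size, while
  \<open>mat_inverse\<close> is characterised by units of the ring of n by n matrices. Comparing
  column counts in the two products recovers the size.\<close>

lemma mat_inverse_invertible:
  fixes A :: "'a :: field mat"
  assumes A: "A \<in> carrier_mat n n" and inv: "invertible_mat A"
  obtains B where "mat_inverse A = Some B" "B \<in> carrier_mat n n" "A * B = 1\<^sub>m n" "B * A = 1\<^sub>m n"
proof -
  from inv obtain B where AB: "A * B = 1\<^sub>m n" and BA: "B * A = 1\<^sub>m (dim_row B)"
    using A by (auto simp: invertible_mat_def inverts_mat_def)
  have "dim_row B = n" using arg_cong[OF BA, of dim_col] A by simp
  moreover have "dim_col B = n" using arg_cong[OF AB, of dim_col] by simp
  ultimately have "B \<in> carrier_mat n n" by auto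
  then have "A \<in> Units (ring_mat TYPE('a) n ())"
    using AB BA A by (auto simp: Units_def ring_mat_def)
  then obtain B' where "mat_inverse A = Some B'"
    using mat_inverse(1)[OF A, where b = "()"] by (cases "mat_inverse A") auto
  with mat_inverse(2)[OF A this] that show ?thesis by blast
qed

text \<open>The deterministic core, to be applied to one outcome at a time: what has to hold almost
  surely is only that C is invertible and that the diagonal blocks of D are injective.\<close>

lemma Q_mat_positive_definite:
  assumes D0: "\<And>i. i \<in> {1..N} \<Longrightarrow> D i 0 \<in> carrier_mat (p i) (d 0)"
    and Di: "\<And>i. i \<in> {1..N} \<Longrightarrow> D i i \<in> carrier_mat (p i) (d i)"
    and C: "\<And>i j. i \<in> {1..N} \<Longrightarrow> j \<in> {1..N} \<Longrightarrow> i \<noteq> j \<Longrightarrow> C i j \<in> carrier_mat (p i) (p j)"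
    and inv: "invertible_mat (C_mat N p C)"
    and inj: "\<And>i x. i \<in> {1..N} \<Longrightarrow> x \<in> carrier_vec (d i) \<Longrightarrow> D i i *\<^sub>v x = 0\<^sub>v (p i) \<Longrightarrow> x = 0\<^sub>v (d i)"
  shows "positive_definite (\<Sum>i=0..N. d i) (Q_mat N p d D C)"
proof -
  define n m where "n = (\<Sum>i=0..N. d i)" and "m = (\<Sum>i=1..N. p i)"
  define CC DD Q0 where "CC = C_mat N p C" and "DD = D_mat N p d D" and "Q0 = Q_x0 N d"
  have CC: "CC \<in> carrier_mat m m" unfolding CC_def m_def using C by (rule C_mat_carrier)
  have DD: "DD \<in> carrier_mat m n" unfolding DD_def m_def n_def using D0 Di by (rule D_mat_carrier)
  have Q0: "Q0 \<in> carrier_mat n n" unfolding Q0_def n_def by (rule Q_x0_carrier)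
  obtain E where E: "mat_inverse CC = Some E" "E \<in> carrier_mat m m" "CC * E = 1\<^sub>m m"
    using mat_inverse_invertible[OF CC] inv unfolding CC_def by metis
  define b where "b = - E * DD"
  have b: "b \<in> carrier_mat m n" unfolding b_def using E DD by auto
  have Q: "Q_mat N p d D C = 2 \<cdot>\<^sub>m (Q0 + b\<^sup>T * b)"
    using E(1) by (simp add: Q_mat_def beta_mat_def b_def Q0_def DD_def CC_def Let_def)
  have bb: "b\<^sup>T * b \<in> carrier_mat n n" using b by auto
  have quad: "x \<bullet> ((2 \<cdot>\<^sub>m (Q0 + b\<^sup>T * b)) *\<^sub>v x) =
      2 * (vec_first x (d 0) \<bullet> vec_first x (d 0) + (b *\<^sub>v x) \<bullet> (b *\<^sub>v x))"
    if x: "x \<in> carrier_vec n" for x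
  proof -
    have bx: "b *\<^sub>v x \<in> carrier_vec m" using b x by auto
    have "x \<bullet> ((2 \<cdot>\<^sub>m (Q0 + b\<^sup>T * b)) *\<^sub>v x) = x \<bullet> (2 \<cdot>\<^sub>v ((Q0 + b\<^sup>T * b) *\<^sub>v x))"
      by (subst smult_mat_mult_vec[of _ n n]) (use Q0 bb x in auto)
    also have "\<dots> = 2 * (x \<bullet> (Q0 *\<^sub>v x + (b\<^sup>T * b) *\<^sub>v x))"
      by (subst add_mult_distrib_mat_vec[of _ n n]) (use Q0 bb x in auto)
    also have "x \<bullet> (Q0 *\<^sub>v x + (b\<^sup>T * b) *\<^sub>v x) = x \<bullet> (Q0 *\<^sub>v x) + x \<bullet> (b\<^sup>T *\<^sub>v (b *\<^sub>v x))"
      by (subst scalar_prod_add_distrib[of _ n]) (use Q0 b x in \<open>auto simp: assoc_mult_mat_vec[of _ n m]\<close>)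
    also have "x \<bullet> (b\<^sup>T *\<^sub>v (b *\<^sub>v x)) = (b *\<^sub>v x) \<bullet> (b *\<^sub>v x)"
      using transpose_vec_mult_scalar[OF b x bx] b x bx
      by (subst comm_scalar_prod[of _ n]) auto
    also have "x \<bullet> (Q0 *\<^sub>v x) = vec_first x (d 0) \<bullet> vec_first x (d 0)"
      unfolding Q0_def using x n_def by (intro Q_x0_quadratic_form) simp
    finally show ?thesis .
  qed
  have pos: "x \<bullet> ((2 \<cdot>\<^sub>m (Q0 + b\<^sup>T * b)) *\<^sub>v x) > 0" if x: "x \<in> carrier_vec n" "x \<noteq> 0\<^sub>v n" for x
  proof (rule ccontr)
    let ?f = "vec_first x (d 0)"
    have bx: "b *\<^sub>v x \<in> carrier_vec m" and f: "?f \<in> carrier_vec (d 0)" using b x by auto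
    assume "\<not> ?thesis"
    \<comment> \<open>Conjugation is the identity on the reals, so the conjugate-square lemmas speak
      of ordinary squared norms.\<close>
    moreover have "?f \<bullet> ?f \<ge> 0" "(b *\<^sub>v x) \<bullet> (b *\<^sub>v x) \<ge> 0"
      using conjugate_square_ge_0_vec[of ?f] conjugate_square_ge_0_vec[of "b *\<^sub>v x"] by auto
    ultimately have "?f \<bullet> ?f = 0" "(b *\<^sub>v x) \<bullet> (b *\<^sub>v x) = 0"
      using quad[OF x(1)] by auto
    then have f0: "?f = 0\<^sub>v (d 0)" and bx0: "b *\<^sub>v x = 0\<^sub>v m"
      using conjugate_square_eq_0_vec[OF f] conjugate_square_eq_0_vec[OF bx] by auto
    have DDx: "DD *\<^sub>v x \<in> carrier_vec m" using DD x by auto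
    \<comment> \<open>Since \<open>E\<close> inverts \<open>CC\<close>, multiplying by
      \<open>CC\<close> removes it from \<open>b\<close> and turns \<open>b *\<^sub>v x\<close>
      being zero into \<open>DD *\<^sub>v x\<close> being zero.\<close>
    have "b *\<^sub>v x = - (E *\<^sub>v (DD *\<^sub>v x))"
      unfolding b_def using E DD x by (simp add: assoc_mult_mat_vec[of _ m m] uminus_mult_mat_vec)
    then have "E *\<^sub>v (DD *\<^sub>v x) = 0\<^sub>v m"
      using bx0 by (metis uminus_uminus_vec uminus_zero_vec)
    then have "CC *\<^sub>v (E *\<^sub>v (DD *\<^sub>v x)) = 0\<^sub>v m"
      using CC by (intro eq_vecI) auto
    then have "DD *\<^sub>v x = 0\<^sub>v m"
      using assoc_mult_mat_vec[OF CC E(2) DDx] E(3) DDx by simp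
    then have "x = 0\<^sub>v n"
      using D_mat_kernel[of N D p d x] D0 Di inj x(1) f0 unfolding DD_def m_def n_def by blast
    with x(2) show False by simp
  qed
  \<comment> \<open>Symmetry, which \<open>positive_definite\<close> demands besides positivity of
    the form.\<close>
  have "(Q0 + b\<^sup>T * b)\<^sup>T = Q0\<^sup>T + (b\<^sup>T * b)\<^sup>T"
    by (rule transpose_add[OF Q0 bb])
  also have "\<dots> = Q0 + b\<^sup>T * b"
    using b by (simp add: transpose_Q_x0 Q0_def transpose_mult[of _ n m _ n])
  finally have "(Q0 + b\<^sup>T * b)\<^sup>T = Q0 + b\<^sup>T * b" .
  moreover have "(2 \<cdot>\<^sub>m (Q0 + b\<^sup>T * b))\<^sup>T = 2 \<cdot>\<^sub>m (Q0 + b\<^sup>T * b)\<^sup>T"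
    by (rule eq_matI) auto
  ultimately have "(2 \<cdot>\<^sub>m (Q0 + b\<^sup>T * b))\<^sup>T = 2 \<cdot>\<^sub>m (Q0 + b\<^sup>T * b)"
    by simp
  then show ?thesis
    unfolding positive_definite_def Q n_def[symmetric] using Q0 bb pos by auto
qed

section \<open>Almost sure positive definiteness\<close>

theorem proposition2:
  fixes M :: "'w measure"
    and N :: nat and p d :: "nat \<Rightarrow> nat"
    and a t :: "'w \<Rightarrow> real vec"
    and D C :: "nat \<Rightarrow> nat \<Rightarrow> 'w \<Rightarrow> real mat"
  assumes "prob_space M"
    and "N \<ge> 1"
    and "\<And>i. i \<le> N \<Longrightarrow> d i \<ge> 1"
    and "\<And>i. i \<in> {1..N} \<Longrightarrow> p i \<ge> 1"
    and "\<And>\<omega>. \<omega> \<in> space M \<Longrightarrow> a \<omega> \<in> carrier_vec (\<Sum>i=1..N. p i)"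
    and "\<And>\<omega>. \<omega> \<in> space M \<Longrightarrow> t \<omega> \<in> carrier_vec (\<Sum>i=1..N. p i)"
    and "\<And>i \<omega>. i \<in> {1..N} \<Longrightarrow> \<omega> \<in> space M \<Longrightarrow> D i 0 \<omega> \<in> carrier_mat (p i) (d 0)"
    and "\<And>i \<omega>. i \<in> {1..N} \<Longrightarrow> \<omega> \<in> space M \<Longrightarrow> D i i \<omega> \<in> carrier_mat (p i) (d i)"
    and "\<And>i j \<omega>. i \<in> {1..N} \<Longrightarrow> j \<in> {1..N} \<Longrightarrow> i \<noteq> j \<Longrightarrow> \<omega> \<in> space M \<Longrightarrow>
           C i j \<omega> \<in> carrier_mat (p i) (p j)"
    and "prob_space.indep_vars M (\<lambda>_. borel) (entry_val a t D C) (entries N p d)"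
    and "\<And>e. e \<in> entries N p d \<Longrightarrow>
           distr M lborel (entry_val a t D C e) = uniform_measure lborel {0..1}"
    and "AE \<omega> in M. invertible_mat (C_mat N p (\<lambda>i j. C i j \<omega>))"
    and "\<And>i. i \<in> {1..N} \<Longrightarrow> p i \<ge> d i"
    and "(\<Sum>i=1..N. p i) \<ge> (\<Sum>i=0..N. d i)"
  shows "AE \<omega> in M. positive_definite (\<Sum>i=0..N. d i)
           (Q_mat N p d (\<lambda>i j. D i j \<omega>) (\<lambda>i j. C i j \<omega>))"
proof -
  interpret prob_space M by fact
  have det: "AE \<omega> in M. Determinant.det (Matrix.mat (d i) (d i) (\<lambda>e. D i i \<omega> $$ e)) \<noteq> 0"
    if i: "i \<in> {1..N}" for i
  proof (rule AE_det_nonzero[where X = "\<lambda>e \<omega>. D i i \<omega> $$ e"])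
    let ?I = "{..<d i} \<times> {..<d i}" and ?f = "\<lambda>(r, c). D_entry i i r c"
    \<comment> \<open>Since \<open>d i\<close> is at most \<open>p i\<close>, the top
      \<open>d i\<close> rows consist of genuine entries of \<open>D i i\<close>.\<close>
    have sub: "?f ` ?I \<subseteq> entries N p d"
      using i assms(13)[OF i] by (auto simp: entries_def)
    have val: "entry_val a t D C (?f e) = (\<lambda>\<omega>. D i i \<omega> $$ e)" for e
      by (cases e) auto
    have "indep_vars ((\<lambda>_. borel) \<circ> ?f) (entry_val a t D C \<circ> ?f) ?I"
      by (rule indep_vars_reindex[OF indep_vars_subset[OF assms(10) sub]]) (auto simp: inj_on_def)
    then show "indep_vars (\<lambda>_. borel) (\<lambda>e \<omega>. D i i \<omega> $$ e) ?I"
      using val by (simp add: comp_def)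
    fix e c assume "e \<in> ?I"
    then have e: "?f e \<in> entries N p d" using sub by blast
    let ?X = "entry_val a t D C (?f e)"
    \<comment> \<open>Measurability is contained in the independence hypothesis,
      \<open>borel\<close> and \<open>lborel\<close> having the same measurable sets.\<close>
    have X [measurable]: "?X \<in> measurable M lborel"
      using assms(10) e unfolding indep_vars_def by auto
    \<comment> \<open>Points are Lebesgue null, hence null for the uniform law, so no entry has an
      atom.\<close>
    have "AE x in distr M lborel ?X. x \<noteq> c"
      unfolding assms(11)[OF e] by (rule AE_uniform_measureI) (auto intro: AE_mp[OF AE_lborel_singleton[of c]])
    then show "AE \<omega> in M. D i i \<omega> $$ e \<noteq> c"
      using AE_distrD[OF X] unfolding val by blast
  qed
  \<comment> \<open>Only finitely many exceptional null sets, one for each diagonal block, have to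
    be merged.\<close>
  have "AE \<omega> in M. \<forall>i\<in>{1..N}. Determinant.det (Matrix.mat (d i) (d i) (\<lambda>e. D i i \<omega> $$ e)) \<noteq> 0"
    by (rule AE_finite_allI) (use det in auto)
  then show ?thesis
    using assms(12) AE_space
  proof eventually_elim
    case (elim \<omega>)
    show ?case
    proof (rule Q_mat_positive_definite)
      fix i x assume "i \<in> {1..N}" "x \<in> carrier_vec (d i)" "D i i \<omega> *\<^sub>v x = 0\<^sub>v (p i)"
      then show "x = 0\<^sub>v (d i)"
        using mult_mat_vec_injective[of "D i i \<omega>" "p i" "d i" x] assms(8,13) elim by auto
    qed (use assms(7-9) elim in auto)
  qed
qed

end
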